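(* As formal power series in $x$ (with coefficients polynomials in $u_1,u_2,u_3,u_4$), $$\sum_{n\ge1}\frac{x^n}{n!}\sum_{\sigma\in\mathfrak S_n}u_1^{\mathrm{val}(\sigma)}u_2^{\mathrm{pk}(\sigma)}u_3^{\mathrm{da}(\sigma)}u_4^{\mathrm{dd}(\sigma)}=\cfrac{u_1x}{1-cx+\cfrac{(c^2-u_1u_2)x^2}{3+\cfrac{(c^2-u_1u_2)x^2}{5+\cfrac{(c^2-u_1u_2)x^2}{7+\cdots}}}},$$ where $c=(u_3+u_4)/2$ (the $k$-th denominator after the first being $2k+1$ and all subsequent numerators equal to $(c^2-u_1u_2)x^2$).
   Context: $\mathfrak S_n$ is the set of permutations of $\{1,\dots,n\}$. For $\sigma=\sigma_1\cdots\sigma_n\in\mathfrak S_n$, with convention $\sigma_0=\sigma_{n+1}=+\infty$, an index $j\in\{1,\dots,n\}$ (letter $\sigma_j$) is a peak if $\sigma_{j-1}<\sigma_j>\sigma_{j+1}$, a valley if $\sigma_{j-1}>\sigma_j<\sigma_{j+1}$, a double ascent if $\sigma_{j-1}<\sigma_j<\sigma_{j+1}$, and a double descent if $\sigma_{j-1}>\sigma_j>\sigma_{j+1}$. $\mathrm{val}(\sigma),\mathrm{pk}(\sigma),\mathrm{da}(\sigma),\mathrm{dd}(\sigma)$ are the numbers of valleys, peaks, double ascents and double descents of $\sigma$. A continued fraction denotes the $x$-adic limit of its convergents. *)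

theory Defs
  imports
    "HOL-Combinatorics.Permutations"
    "HOL-Computational_Algebra.Formal_Power_Series"
    "HOL-Library.Extended_Nat"
begin

(* The one-line word of a permutation of {1..n}, with sigma_0 = sigma_(n+1) = +infinity. *)
definition letter :: "nat \<Rightarrow> (nat \<Rightarrow> nat) \<Rightarrow> nat \<Rightarrow> enat" where
  "letter n \<sigma> j = (if j \<in> {1..n} then enat (\<sigma> j) else \<infinity>)"

definition is_peak :: "nat \<Rightarrow> (nat \<Rightarrow> nat) \<Rightarrow> nat \<Rightarrow> bool" where
  "is_peak n \<sigma> j \<longleftrightarrow>
     letter n \<sigma> (j - 1) < letter n \<sigma> j \<and> letter n \<sigma> j > letter n \<sigma> (j + 1)"

definition is_valley :: "nat \<Rightarrow> (nat \<Rightarrow> nat) \<Rightarrow> nat \<Rightarrow> bool" where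
  "is_valley n \<sigma> j \<longleftrightarrow>
     letter n \<sigma> (j - 1) > letter n \<sigma> j \<and> letter n \<sigma> j < letter n \<sigma> (j + 1)"

definition is_double_ascent :: "nat \<Rightarrow> (nat \<Rightarrow> nat) \<Rightarrow> nat \<Rightarrow> bool" where
  "is_double_ascent n \<sigma> j \<longleftrightarrow>
     letter n \<sigma> (j - 1) < letter n \<sigma> j \<and> letter n \<sigma> j < letter n \<sigma> (j + 1)"

definition is_double_descent :: "nat \<Rightarrow> (nat \<Rightarrow> nat) \<Rightarrow> nat \<Rightarrow> bool" where
  "is_double_descent n \<sigma> j \<longleftrightarrow>
     letter n \<sigma> (j - 1) > letter n \<sigma> j \<and> letter n \<sigma> j > letter n \<sigma> (j + 1)"

definition pk :: "nat \<Rightarrow> (nat \<Rightarrow> nat) \<Rightarrow> nat" where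
  "pk n \<sigma> = card {j \<in> {1..n}. is_peak n \<sigma> j}"

definition val :: "nat \<Rightarrow> (nat \<Rightarrow> nat) \<Rightarrow> nat" where
  "val n \<sigma> = card {j \<in> {1..n}. is_valley n \<sigma> j}"

definition da :: "nat \<Rightarrow> (nat \<Rightarrow> nat) \<Rightarrow> nat" where
  "da n \<sigma> = card {j \<in> {1..n}. is_double_ascent n \<sigma> j}"

definition dd :: "nat \<Rightarrow> (nat \<Rightarrow> nat) \<Rightarrow> nat" where
  "dd n \<sigma> = card {j \<in> {1..n}. is_double_descent n \<sigma> j}"

(* The m-th convergent of a 0 / (b 0 + a 1 / (b 1 + a 2 / (b 2 + ...))): the fraction
   a 0 / (b 0 + ... + a (m - 1) / b (m - 1)). *)
fun cf_convergent :: "(nat \<Rightarrow> 'a) \<Rightarrow> (nat \<Rightarrow> 'a) \<Rightarrow> nat \<Rightarrow> 'a::{zero,plus,inverse}" where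
  "cf_convergent a b 0 = 0"
| "cf_convergent a b (Suc m) =
     a 0 / (b 0 + cf_convergent (\<lambda>k. a (Suc k)) (\<lambda>k. b (Suc k)) m)"

(* For formal power series, convergence is in the metric of the library, which is the x-adic one. *)
definition cf_has_value ::
    "(nat \<Rightarrow> 'a) \<Rightarrow> (nat \<Rightarrow> 'a) \<Rightarrow> 'a::{zero,plus,inverse,topological_space} \<Rightarrow> bool" where
  "cf_has_value a b v \<longleftrightarrow> cf_convergent a b \<longlonglongrightarrow> v"

end

theory Submission
  imports Defs "HOL-Combinatorics.Multiset_Permutations"
begin

text \<open>
  Let \<open>F\<close> be the generating function. The largest letter of a word behaves like \<open>\<infinity>\<close> for the words to
  its left and right, and it is itself a peak, double ascent, double descent or valley according to
  which of these two words are empty. Hence \<open>F' = u\<^sub>1 + 2 c F + u\<^sub>2 F\<^sup>2\<close> with \<open>F(0) = 0\<close>, whose solution is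
  \<open>F = u\<^sub>1 s / (s' - c s)\<close> for \<open>s = sinh (\<surd>D x) / \<surd>D\<close> and \<open>D = c\<^sup>2 - u\<^sub>1 u\<^sub>2\<close>. As in Lambert's continued fraction
  of the tangent, \<open>s'\<close> and \<open>s / x\<close> are the first two terms \<open>S\<^sub>0\<close>, \<open>S\<^sub>1\<close> of a sequence of power series
  with \<open>S\<^sub>k = (2k + 1) S\<^bsub>k+1\<^esub> + D x\<^sup>2 S\<^bsub>k+2\<^esub>\<close>, so that the quotients
  \<open>D x\<^sup>2 S\<^bsub>k+1\<^esub> / S\<^sub>k\<close> are the tails of the continued fraction; every additional level gains a
  factor \<open>x\<close> in the error.
\<close>

section \<open>Power series behind Lambert's continued fraction\<close>

text \<open>\<open>1 / (2m - 1)!!\<close>\<close>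
primrec inv_odd_fact :: "nat \<Rightarrow> 'a::field_char_0" where
  "inv_odd_fact 0 = 1"
| "inv_odd_fact (Suc m) = inv_odd_fact m / of_nat (2 * m + 1)"

lemma inv_odd_fact_rec: "of_nat (2 * m + 1) * inv_odd_fact (Suc m) = (inv_odd_fact m :: 'a::field_char_0)"
  by (simp del: of_nat_add of_nat_mult of_nat_Suc add: of_nat_eq_0_iff)

text \<open>The coefficient of \<open>D^j x^(2j)\<close> in the \<open>k\<close>-th series. It is
  \<open>1 / (2j)!\<close> for \<open>k = 0\<close> and \<open>1 / (2j + 1)!\<close> for
  \<open>k = 1\<close>, since \<open>(2j)! = (2j - 1)!! 2^j j!\<close>.\<close>

definition lambert_coeff :: "nat \<Rightarrow> nat \<Rightarrow> 'a::field_char_0" where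
  "lambert_coeff k j = inv_odd_fact (j + k) / (2 ^ j * fact j)"

lemma lambert_coeff_left:
  "of_nat (2 * (j + k) + 1) * lambert_coeff (Suc k) j = (lambert_coeff k j :: 'a::field_char_0)"
  unfolding lambert_coeff_def times_divide_eq_right add_Suc_right inv_odd_fact_rec ..

text \<open>Both coefficients contain the same double factorial, as only the sum of the two indices
  enters it; the remaining factor comes from \<open>2 ^ j * fact j\<close>.\<close>

lemma lambert_coeff_right:
  "of_nat (2 * Suc j) * lambert_coeff k (Suc j) = (lambert_coeff (Suc k) j :: 'a::field_char_0)"
proof -
  have "of_nat (Suc j) \<noteq> (0::'a)" by (simp only: of_nat_eq_0_iff)
  then show ?thesis
    unfolding lambert_coeff_def of_nat_mult
    by (simp add: field_simps del: of_nat_Suc inv_odd_fact.simps)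
qed

text \<open>\<open>lambert_fps D 0 = cosh (\<surd>D x)\<close> and \<open>x * lambert_fps D 1 = sinh (\<surd>D x) / \<surd>D\<close>, without square roots.\<close>
definition lambert_fps :: "'a \<Rightarrow> nat \<Rightarrow> 'a::field_char_0 fps" where
  "lambert_fps D k = Abs_fps (\<lambda>n. if even n then D ^ (n div 2) * lambert_coeff k (n div 2) else 0)"

lemma lambert_fps_0_nth_0: "fps_nth (lambert_fps D 0) 0 = 1"
  by (simp add: lambert_fps_def lambert_coeff_def)

text \<open>At \<open>x^(2i)\<close> the factor \<open>2 (i + k) + 1\<close> of
  \<open>lambert_coeff_left\<close> splits as \<open>(2k + 1) + 2i\<close>;
  \<open>lambert_coeff_right\<close> turns the second summand into the coefficient with indices
  \<open>k + 2\<close> and \<open>i - 1\<close>.\<close>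

lemma lambert_fps_rec:
  "lambert_fps D k = of_nat (2 * k + 1) * lambert_fps D (Suc k)
     + fps_const D * fps_X\<^sup>2 * lambert_fps D (Suc (Suc k))"
proof (rule fps_ext)
  fix n
  have nth: "fps_nth (fps_const D * fps_X\<^sup>2 * g) n = (if n < 2 then 0 else D * fps_nth g (n - 2))" for g
    by (simp add: mult.assoc fps_X_power_mult_nth)
  have nth': "fps_nth (of_nat (2 * k + 1) * g) n = of_nat (2 * k + 1) * fps_nth g n" for g :: "'a fps"
    by (simp only: fps_of_nat[symmetric] fps_mult_left_const_nth)
  show "fps_nth (lambert_fps D k) n = fps_nth (of_nat (2 * k + 1) * lambert_fps D (Suc k)
     + fps_const D * fps_X\<^sup>2 * lambert_fps D (Suc (Suc k))) n"
  proof (cases "even n")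
    case False
    then show ?thesis unfolding fps_add_nth nth nth' by (auto simp: lambert_fps_def)
  next
    case True
    then obtain i where n: "n = 2 * i" by blast
    show ?thesis
    proof (cases i)
      case 0
      then show ?thesis
        unfolding fps_add_nth nth nth' using lambert_coeff_left[of 0 k, where 'a='a]
        by (simp add: n lambert_fps_def)
    next
      case (Suc j)
      have "(lambert_coeff k i :: 'a) = of_nat (2 * k + 1) * lambert_coeff (Suc k) i
          + of_nat (2 * Suc j) * lambert_coeff (Suc k) i"
        unfolding lambert_coeff_left[of i k, symmetric] by (simp add: Suc algebra_simps)
      also have "of_nat (2 * Suc j) * lambert_coeff (Suc k) i = (lambert_coeff (Suc (Suc k)) j :: 'a)"
        unfolding Suc by (rule lambert_coeff_right)
      finally show ?thesis
        unfolding fps_add_nth nth nth'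
        by (simp add: n Suc lambert_fps_def distrib_left mult.left_commute mult.assoc del: of_nat_add of_nat_mult of_nat_Suc)
    qed
  qed
qed

text \<open>\<open>sinh' = cosh\<close>: differentiation multiplies the coefficient of
  \<open>x^(2j+1)\<close> by \<open>2j + 1\<close>, which \<open>lambert_coeff_left\<close>
  absorbs.\<close>

lemma lambert_fps_deriv_X_mult: "fps_deriv (fps_X * lambert_fps D 1) = lambert_fps D 0"
proof (rule fps_ext)
  fix n
  show "fps_nth (fps_deriv (fps_X * lambert_fps D 1)) n = fps_nth (lambert_fps D 0) n"
  proof (cases "even n")
    case True
    then obtain j where "n = 2 * j" by blast
    then show ?thesis using lambert_coeff_left[of j 0, where 'a='a, symmetric]
      by (simp add: lambert_fps_def mult.left_commute del: fps_deriv_mult)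
  next
    case False
    then show ?thesis by (simp add: lambert_fps_def del: fps_deriv_mult)
  qed
qed

lemma lambert_fps_deriv: "fps_deriv (lambert_fps D 0) = fps_const D * (fps_X * lambert_fps D 1)"
proof (rule fps_ext)
  fix n
  show "fps_nth (fps_deriv (lambert_fps D 0)) n = fps_nth (fps_const D * (fps_X * lambert_fps D 1)) n"
  proof (cases "odd n")
    case True
    then obtain j where n: "n = 2 * j + 1" using oddE by blast
    have e: "even (n + 1)" "(n + 1) div 2 = Suc j" "n + 1 = 2 * Suc j" using n by auto
    have "fps_nth (fps_deriv (lambert_fps D 0)) n
        = D ^ Suc j * (of_nat (2 * Suc j) * lambert_coeff 0 (Suc j))"
      by (simp only: fps_deriv_nth lambert_fps_def fps_nth_Abs_fps e(1,2) if_True mult.left_commute)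
        (simp only: e(3) mult.left_commute)
    also have "\<dots> = D ^ Suc j * lambert_coeff 1 j" by (simp only: lambert_coeff_right One_nat_def)
    finally show ?thesis by (simp add: n lambert_fps_def mult.assoc)
  next
    case False
    then show ?thesis by (simp add: lambert_fps_def)
  qed
qed

text \<open>\<open>cosh^2 - sinh^2 = 1\<close>: by the two derivative rules the difference has
  derivative zero, so it equals its constant coefficient.\<close>

lemma lambert_fps_pythagoras:
  "(lambert_fps D 0)\<^sup>2 - fps_const D * (fps_X * lambert_fps D 1)\<^sup>2 = 1"
proof -
  let ?C = "lambert_fps D 0" and ?S = "fps_X * lambert_fps D 1"
  have "fps_deriv (?C\<^sup>2 - fps_const D * ?S\<^sup>2)
      = 2 * ?C * fps_deriv ?C - fps_const D * (2 * ?S * fps_deriv ?S)"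
    by (simp add: power2_eq_square algebra_simps)
  also have "\<dots> = 0"
    unfolding lambert_fps_deriv_X_mult lambert_fps_deriv by (simp add: algebra_simps)
  finally show ?thesis
    unfolding fps_deriv_eq_0_iff by (simp add: power2_eq_square lambert_fps_0_nth_0)
qed

section \<open>Convergents of the tails\<close>

text \<open>The convergents approximate \<open>D x^2 S_(k+1) / S_k\<close> to order
  \<open>x^m\<close>, phrased as divisibility after clearing the denominator. The zero constant
  coefficient is carried along because it makes each denominator invertible. Dropping the top level
  shifts \<open>k\<close>, hence \<open>k\<close> varies in the induction.\<close>

lemma cf_convergent_lambert:
  fixes D :: "'a::field_char_0" and k m :: nat
  defines "C \<equiv> cf_convergent (\<lambda>_. fps_const D * fps_X\<^sup>2) (\<lambda>i. of_nat (2 * (k + i) + 1)) m"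
  shows "fps_nth C 0 = 0"
    and "fps_X ^ m dvd C * lambert_fps D k - fps_const D * fps_X\<^sup>2 * lambert_fps D (Suc k)"
proof -
  have "fps_nth C 0 = 0 \<and> fps_X ^ m dvd C * lambert_fps D k - fps_const D * fps_X\<^sup>2 * lambert_fps D (Suc k)"
    unfolding C_def
  proof (induction m arbitrary: k)
    case 0
    then show ?case by simp
  next
    case (Suc m)
    define C' where "C' = cf_convergent (\<lambda>_. fps_const D * fps_X\<^sup>2) (\<lambda>i. of_nat (2 * (Suc k + i) + 1)) m"
    define B :: "'a fps" where "B = of_nat (2 * k + 1)"
    define Y where "Y = fps_const D * fps_X\<^sup>2"
    have C'0: "fps_nth C' 0 = 0"
      and dvd: "fps_X ^ m dvd C' * lambert_fps D (Suc k) - Y * lambert_fps D (Suc (Suc k))"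
      using Suc[of "Suc k"] by (simp_all only: C'_def Y_def)
    have C_eq: "cf_convergent (\<lambda>_. Y) (\<lambda>i. of_nat (2 * (k + i) + 1)) (Suc m) = Y / (B + C')"
      unfolding cf_convergent.simps C'_def B_def Y_def by (simp only: add_0_right add_Suc_right add_Suc)
    have "fps_nth B 0 \<noteq> 0"
      unfolding B_def fps_of_nat[symmetric] fps_nth_fps_const if_P[OF refl] of_nat_eq_0_iff by simp
    then have unit: "fps_nth (B + C') 0 \<noteq> 0" using C'0 by simp
    then have inv: "inverse (B + C') * (B + C') = 1" by (rule inverse_mult_eq_1)
    have quot: "Y / (B + C') = Y * inverse (B + C')" using unit by (rule fps_divide_unit)
    \<comment> \<open>The error at this level is the error one level down times
      \<open>-Y / (B + C')\<close>; a factor \<open>fps_X\<close> of \<open>Y\<close> raises the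
      order from \<open>m\<close> to \<open>m + 1\<close>.\<close>
    have "Y / (B + C') * lambert_fps D k - Y * lambert_fps D (Suc k)
        = Y * inverse (B + C') * (lambert_fps D k - (B + C') * lambert_fps D (Suc k))"
      using inv unfolding quot by algebra
    also have "lambert_fps D k - (B + C') * lambert_fps D (Suc k)
        = - (C' * lambert_fps D (Suc k) - Y * lambert_fps D (Suc (Suc k)))"
      by (subst lambert_fps_rec) (simp add: B_def Y_def algebra_simps)
    finally have eq: "Y / (B + C') * lambert_fps D k - Y * lambert_fps D (Suc k) =
        Y * inverse (B + C') * - (C' * lambert_fps D (Suc k) - Y * lambert_fps D (Suc (Suc k)))" .
    have "fps_X dvd Y * inverse (B + C')"
      unfolding Y_def power2_eq_square by (simp add: dvd_mult dvd_mult2)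
    then have "fps_X ^ Suc m dvd Y / (B + C') * lambert_fps D k - Y * lambert_fps D (Suc k)"
      unfolding eq power_Suc by (rule mult_dvd_mono) (use dvd in \<open>simp only: dvd_minus_iff\<close>)
    moreover have "fps_nth (Y / (B + C')) 0 = 0"
      unfolding quot by (simp add: Y_def power2_eq_square)
    ultimately show ?case unfolding Y_def[symmetric] C_eq by simp
  qed
  then show "fps_nth C 0 = 0"
    and "fps_X ^ m dvd C * lambert_fps D k - fps_const D * fps_X\<^sup>2 * lambert_fps D (Suc k)" by auto
qed

section \<open>The Riccati equation and the continued fraction of its solution\<close>

definition riccati_fps :: "'a \<Rightarrow> 'a \<Rightarrow> 'a \<Rightarrow> 'a::field_char_0 fps" where
  "riccati_fps u\<^sub>1 u\<^sub>2 c = (let D = c\<^sup>2 - u\<^sub>1 * u\<^sub>2; S = fps_X * lambert_fps D 1 in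
     fps_const u\<^sub>1 * S * inverse (lambert_fps D 0 - fps_const c * S))"

lemma riccati_fps_nth_0: "fps_nth (riccati_fps u\<^sub>1 u\<^sub>2 c) 0 = 0"
  by (simp add: riccati_fps_def Let_def)

text \<open>With \<open>W\<close> the denominator, a unit, both sides times \<open>W^2\<close> equal
  \<open>u\<^sub>1\<close>: on the left by the quotient rule and the Pythagorean identity, on the
  right because \<open>W^2 + 2 c S W + u\<^sub>1 u\<^sub>2 S^2 = (W + c S)^2 - D S^2\<close> and
  \<open>W + c S = C\<close>.\<close>

lemma riccati_fps_deriv:
  "fps_deriv (riccati_fps u\<^sub>1 u\<^sub>2 c) = fps_const u\<^sub>1 + fps_const (2 * c) * riccati_fps u\<^sub>1 u\<^sub>2 c
     + fps_const u\<^sub>2 * (riccati_fps u\<^sub>1 u\<^sub>2 c)\<^sup>2"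
proof -
  define D where "D = c\<^sup>2 - u\<^sub>1 * u\<^sub>2"
  define S where "S = fps_X * lambert_fps D 1"
  define C where "C = lambert_fps D 0"
  define W where "W = C - fps_const c * S"
  define F where "F = riccati_fps u\<^sub>1 u\<^sub>2 c"
  define d a b e where "d = fps_const D" and "a = fps_const u\<^sub>1" and "b = fps_const u\<^sub>2" and "e = fps_const c"
  have F_eq: "F = a * S * inverse W"
    by (simp add: F_def riccati_fps_def Let_def W_def C_def S_def D_def a_def)
  have "fps_nth W 0 \<noteq> 0" by (simp add: W_def C_def S_def lambert_fps_0_nth_0)
  then have inv: "inverse W * W = 1" by (rule inverse_mult_eq_1)
  have FW: "F * W = a * S" using inv unfolding F_eq by algebra
  have S': "fps_deriv S = C" and C': "fps_deriv C = d * S"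
    unfolding S_def C_def d_def by (rule lambert_fps_deriv_X_mult lambert_fps_deriv)+
  have W': "fps_deriv W = d * S - e * C" by (simp add: W_def S' C' e_def)
  have "fps_deriv (F * W) = a * C" unfolding FW by (simp add: S' a_def)
  then have FW': "F * (d * S - e * C) + fps_deriv F * W = a * C" by (simp add: W')
  have pyth: "C\<^sup>2 - d * S\<^sup>2 = 1" unfolding C_def d_def S_def by (rule lambert_fps_pythagoras)
  have d: "d = e\<^sup>2 - a * b" by (simp add: d_def e_def a_def b_def D_def power2_eq_square)
  have We: "W = C - e * S" by (simp add: W_def e_def)
  have "fps_deriv F * W\<^sup>2 = a * C * W - a * S * (d * S - e * C)"
    using FW' FW by algebra
  also have "\<dots> = a" using pyth We by algebra
  also have "\<dots> = (a + 2 * e * F + b * F\<^sup>2) * W\<^sup>2"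
    using pyth We FW d by algebra
  finally have "fps_deriv F * W\<^sup>2 = (a + 2 * e * F + b * F\<^sup>2) * W\<^sup>2" .
  then have "fps_deriv F = a + 2 * e * F + b * F\<^sup>2" using inv by algebra
  then show ?thesis
    unfolding F_def a_def b_def e_def
    by (simp only: fps_const_mult[symmetric] numeral_fps_const[symmetric])
qed

text \<open>Dividing numerator and denominator of \<open>F\<close> by \<open>S1\<close> and using
  \<open>S0 = S1 + Y S2\<close> gives \<open>F = u\<^sub>1 x / (1 - c x + Y S2 / S1)\<close>, where
  \<open>Y S2 / S1\<close> is the limit of the regular tail starting at
  \<open>k = 1\<close>.\<close>

lemma cf_has_value_riccati:
  "cf_has_value
     (\<lambda>k. if k = 0 then fps_const u\<^sub>1 * fps_X else fps_const (c\<^sup>2 - u\<^sub>1 * u\<^sub>2) * fps_X\<^sup>2)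
     (\<lambda>k. if k = 0 then 1 - fps_const c * fps_X else of_nat (2 * k + 1))
     (riccati_fps u\<^sub>1 u\<^sub>2 (c::'a::field_char_0))"
  (is "cf_has_value ?a ?b _")
proof -
  define D where "D = c\<^sup>2 - u\<^sub>1 * u\<^sub>2"
  define S0 S1 S2 where "S0 = lambert_fps D 0" and "S1 = lambert_fps D 1" and "S2 = lambert_fps D 2"
  define W where "W = S0 - fps_const c * (fps_X * S1)"
  define F where "F = riccati_fps u\<^sub>1 u\<^sub>2 c"
  define Y where "Y = fps_const D * fps_X\<^sup>2"
  have F_eq: "F = fps_const u\<^sub>1 * (fps_X * S1) * inverse W"
    by (simp add: F_def riccati_fps_def Let_def W_def S0_def S1_def D_def)
  have "fps_nth W 0 \<noteq> 0" by (simp add: W_def S0_def lambert_fps_0_nth_0)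
  then have invW: "inverse W * W = 1" by (rule inverse_mult_eq_1)
  have S0: "S0 = S1 + Y * S2"
    unfolding S0_def S1_def S2_def Y_def by (subst lambert_fps_rec) (simp add: numeral_2_eq_2)
  have dvd: "fps_X ^ m dvd cf_convergent ?a ?b (Suc m) - F" for m
  proof -
    define C where "C = cf_convergent (\<lambda>_. Y) (\<lambda>i. of_nat (2 * (1 + i) + 1)) m"
    define V where "V = 1 - fps_const c * fps_X + C"
    have C0: "fps_nth C 0 = 0" and C: "fps_X ^ m dvd C * S1 - Y * S2"
      unfolding C_def Y_def S1_def S2_def
      using cf_convergent_lambert[where D = D and k = 1 and m = m] by (simp_all only: One_nat_def numeral_2_eq_2)
    have eq: "cf_convergent ?a ?b (Suc m) = fps_const u\<^sub>1 * fps_X / V"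
      unfolding cf_convergent.simps V_def C_def Y_def D_def by simp
    have V0: "fps_nth V 0 \<noteq> 0" using C0 by (simp add: V_def)
    have invV: "inverse V * V = 1" using V0 by (rule inverse_mult_eq_1)
    \<comment> \<open>\<open>W\<close> arises from \<open>V * S1\<close> when \<open>C * S1\<close>
      is replaced by \<open>Y * S2\<close>, so the tail estimate controls this difference.\<close>
    have "W - V * S1 = - (C * S1 - Y * S2)"
      unfolding W_def V_def S0 by (simp add: algebra_simps)
    moreover have "fps_const u\<^sub>1 * fps_X / V - F
        = fps_const u\<^sub>1 * fps_X * inverse V * inverse W * (W - V * S1)"
      unfolding F_eq fps_divide_unit[OF V0] using invV invW by algebra
    ultimately have "fps_const u\<^sub>1 * fps_X / V - F
        = fps_const u\<^sub>1 * fps_X * inverse V * inverse W * - (C * S1 - Y * S2)"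
      by (simp only:)
    then show ?thesis unfolding eq using C by (metis dvd_minus_iff dvd_mult)
  qed
  have "cf_convergent ?a ?b \<longlonglongrightarrow> F"
  proof (rule tendsto_fpsI)
    fix n
    show "\<forall>\<^sub>F m in sequentially. fps_nth (cf_convergent ?a ?b m) n = fps_nth F n"
      using eventually_ge_at_top[of "Suc (Suc n)"]
    proof eventually_elim
      case (elim m)
      \<comment> \<open>The estimate for the \<open>m\<close>-th convergent is modulo
        \<open>fps_X ^ (m - 1)\<close>, hence the bound \<open>n + 2\<close>.\<close>
      then obtain k where m: "m = Suc k" "n < k" by (cases m) auto
      obtain G where "cf_convergent ?a ?b m - F = fps_X ^ k * G"
        using dvd[of k] unfolding m by (auto elim: dvdE)
      then have "fps_nth (cf_convergent ?a ?b m - F) n = 0"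
        using m(2) by (simp add: fps_X_power_mult_nth)
      then show ?case by simp
    qed
  qed
  then show ?thesis unfolding cf_has_value_def F_def .
qed

section \<open>Permutations as words, and cutting a word at a letter\<close>

text \<open>A permutation of \<open>{1..n}\<close> is the identity elsewhere, so its word determines
  it; surjectivity follows by counting, as both sets have \<open>n!\<close> elements.\<close>

lemma bij_betw_permutes_words:
  "bij_betw (\<lambda>\<sigma>. map \<sigma> [1..<Suc n]) {\<sigma>. \<sigma> permutes {1..n}} (permutations_of_set {1..n})"
proof -
  let ?f = "\<lambda>\<sigma>. map \<sigma> [1..<Suc n]" and ?P = "{\<sigma>. \<sigma> permutes {1..n}}"
  have set: "set [1..<Suc n] = {1..n}" by auto
  have inj: "inj_on ?f ?P"
  proof (rule inj_onI)
    fix \<sigma> \<tau> :: "nat \<Rightarrow> nat"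
    assume "\<sigma> \<in> ?P" "\<tau> \<in> ?P" "?f \<sigma> = ?f \<tau>"
    then have "\<sigma> x = \<tau> x" for x
      unfolding map_eq_conv set using permutes_not_in by (metis mem_Collect_eq)
    then show "\<sigma> = \<tau>" by auto
  qed
  have sub: "?f ` ?P \<subseteq> permutations_of_set {1..n}"
  proof
    fix xs assume "xs \<in> ?f ` ?P"
    then obtain \<sigma> where "\<sigma> permutes {1..n}" "xs = ?f \<sigma>" by auto
    then show "xs \<in> permutations_of_set {1..n}"
      by (intro permutations_of_setI)
        (simp_all only: set_map set permutes_image distinct_map permutes_inj_on distinct_upt)
  qed
  have "card (?f ` ?P) = card (permutations_of_set {1..n})"
    unfolding card_image[OF inj] using card_permutations[of "{1..n}" n] by simp
  with sub have "?f ` ?P = permutations_of_set {1..n}"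
    by (intro card_subset_eq) auto
  with inj show ?thesis by (simp add: bij_betw_def)
qed

text \<open>Each word is cut at its only occurrence of \<open>m\<close>, and \<open>B\<close> is the
  set of letters to the left. Reading up to the first \<open>m\<close> recovers the two
  parts.\<close>

lemma sum_permutations_of_set_split:
  fixes f :: "'a list \<Rightarrow> 'b::comm_monoid_add"
  assumes "finite A" "m \<notin> A"
  shows "(\<Sum>zs\<in>permutations_of_set (insert m A). f zs)
    = (\<Sum>B\<in>Pow A. \<Sum>xs\<in>permutations_of_set B. \<Sum>ys\<in>permutations_of_set (A - B). f (xs @ m # ys))"
proof -
  let ?T = "SIGMA B:Pow A. permutations_of_set B \<times> permutations_of_set (A - B)"
  have "(\<Sum>B\<in>Pow A. \<Sum>xs\<in>permutations_of_set B. \<Sum>ys\<in>permutations_of_set (A - B). f (xs @ m # ys))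
      = (\<Sum>(B, xs, ys)\<in>?T. f (xs @ m # ys))"
    using assms(1) by (simp add: sum.Sigma sum.cartesian_product)
  also have "\<dots> = (\<Sum>zs\<in>permutations_of_set (insert m A). f zs)"
  proof (rule sum.reindex_bij_witness[of _
        "\<lambda>zs. (set (takeWhile (\<lambda>z. z \<noteq> m) zs), takeWhile (\<lambda>z. z \<noteq> m) zs, tl (dropWhile (\<lambda>z. z \<noteq> m) zs))"
        "\<lambda>(B, xs, ys). xs @ m # ys"])
    fix t assume t: "t \<in> ?T"
    then obtain B xs ys where t_eq: "t = (B, xs, ys)" and B: "B \<subseteq> A"
      and xs: "set xs = B" "distinct xs" and ys: "set ys = A - B" "distinct ys"
      by (auto simp: permutations_of_set_def)
    have "takeWhile (\<lambda>z. z \<noteq> m) (xs @ m # ys) = xs"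
      "dropWhile (\<lambda>z. z \<noteq> m) (xs @ m # ys) = m # ys"
      using xs B assms(2) by (auto simp: takeWhile_append dropWhile_append)
    then show "(\<lambda>zs. (set (takeWhile (\<lambda>z. z \<noteq> m) zs), takeWhile (\<lambda>z. z \<noteq> m) zs,
        tl (dropWhile (\<lambda>z. z \<noteq> m) zs))) ((\<lambda>(B, xs, ys). xs @ m # ys) t) = t"
      by (simp add: t_eq xs)
    show "(\<lambda>(B, xs, ys). xs @ m # ys) t \<in> permutations_of_set (insert m A)"
      using B xs ys assms(2) by (auto simp: t_eq permutations_of_set_def)
  next
    fix zs assume "zs \<in> permutations_of_set (insert m A)"
    then have zs: "set zs = insert m A" "distinct zs" by (auto simp: permutations_of_set_def)
    then obtain xs ys where split: "zs = xs @ m # ys" "m \<notin> set xs"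
      using split_list_first[of m zs] by auto
    have 1: "takeWhile (\<lambda>z. z \<noteq> m) zs = xs" "dropWhile (\<lambda>z. z \<noteq> m) zs = m # ys"
      using split by (auto simp: takeWhile_append dropWhile_append)
    then show "(\<lambda>(B, xs, ys). xs @ m # ys) (set (takeWhile (\<lambda>z. z \<noteq> m) zs),
        takeWhile (\<lambda>z. z \<noteq> m) zs, tl (dropWhile (\<lambda>z. z \<noteq> m) zs)) = zs"
      by (simp add: split)
    show "(set (takeWhile (\<lambda>z. z \<noteq> m) zs), takeWhile (\<lambda>z. z \<noteq> m) zs,
        tl (dropWhile (\<lambda>z. z \<noteq> m) zs)) \<in> ?T"
      unfolding 1 using zs split assms(2) by (auto simp: permutations_of_set_def)
  qed auto
  finally show ?thesis ..
qed

lemma sum_Pow_card: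
  fixes g :: "nat \<Rightarrow> 'b::comm_semiring_1"
  assumes "finite A"
  shows "(\<Sum>B\<in>Pow A. g (card B)) = (\<Sum>k\<le>card A. of_nat (card A choose k) * g k)"
proof -
  have "(\<Sum>B\<in>Pow A. g (card B)) = (\<Sum>k\<le>card A. \<Sum>B\<in>{B \<in> Pow A. card B = k}. g (card B))"
    using assms by (intro sum.group[symmetric]) (auto intro: card_mono)
  also have "\<dots> = (\<Sum>k\<le>card A. of_nat (card A choose k) * g k)"
    by (intro sum.cong refl) (simp add: n_subsets[OF assms])
  finally show ?thesis .
qed

section \<open>Weights of words\<close>

context
  fixes u\<^sub>1 u\<^sub>2 u\<^sub>3 u\<^sub>4 :: "'a::field_char_0"
begin

text \<open>
  At most one of the four conditions holds; the product form makes the weight of a permutation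
  factor over its positions without case distinctions.
\<close>
definition letter_wt :: "enat \<Rightarrow> enat \<Rightarrow> enat \<Rightarrow> 'a" where
  "letter_wt l x r = (if l > x \<and> x < r then u\<^sub>1 else 1) * (if l < x \<and> x > r then u\<^sub>2 else 1)
     * (if l < x \<and> x < r then u\<^sub>3 else 1) * (if l > x \<and> x > r then u\<^sub>4 else 1)"

definition first_letter :: "nat list \<Rightarrow> enat" where
  "first_letter xs = (case xs of [] \<Rightarrow> \<infinity> | x # _ \<Rightarrow> enat x)"

text \<open>The left neighbour is a parameter: \<open>\<infinity>\<close> at the start of a word,
  the preceding letter in the recursion. The right boundary \<open>\<infinity>\<close> is built into
  \<open>first_letter\<close>.\<close>

primrec word_wt :: "enat \<Rightarrow> nat list \<Rightarrow> 'a" where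
  "word_wt l [] = 1"
| "word_wt l (x # xs) = letter_wt l (enat x) (first_letter xs) * word_wt (enat x) xs"

text \<open>Only the first letter of \<open>ys\<close> sees the left neighbour, and it is smaller
  than both \<open>m\<close> and \<open>\<infinity>\<close>.\<close>

lemma word_wt_left_infinity:
  assumes "\<forall>y\<in>set ys. y < m"
  shows "word_wt (enat m) ys = word_wt \<infinity> ys"
  using assms by (cases ys) (auto simp: letter_wt_def)

text \<open>Between two infinite neighbours \<open>m\<close> is a valley; before a smaller letter it
  is a double descent.\<close>

lemma word_wt_max_first:
  assumes "\<forall>y\<in>set ys. y < m"
  shows "word_wt \<infinity> (m # ys) = (if ys = [] then u\<^sub>1 else u\<^sub>4 * word_wt \<infinity> ys)"
  using assms word_wt_left_infinity[OF assms]
  by (cases ys) (auto simp: letter_wt_def first_letter_def)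

text \<open>After a smaller letter, \<open>m\<close> is a double ascent if it ends the word and a
  peak otherwise. The last letter of \<open>xs\<close> has \<open>m\<close> instead of
  \<open>\<infinity>\<close> on its right, which compares the same way.\<close>

lemma word_wt_max_later:
  assumes "xs \<noteq> []" "\<forall>x\<in>set xs. x < m" "\<forall>y\<in>set ys. y < m"
  shows "word_wt l (xs @ m # ys) = word_wt l xs * (if ys = [] then u\<^sub>3 else u\<^sub>2 * word_wt \<infinity> ys)"
  using assms(1,2)
proof (induction xs arbitrary: l rule: list_nonempty_induct)
  case (single x)
  then show ?case
    using assms(3) word_wt_left_infinity[OF assms(3)]
    by (cases ys) (auto simp: letter_wt_def first_letter_def)
next
  case (cons x xs)
  then have "first_letter (xs @ m # ys) = first_letter xs"
    by (cases xs) (auto simp: first_letter_def)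
  with cons show ?case by (simp add: mult.assoc)
qed

lemma word_wt_eq_prod:
  "word_wt l xs = (\<Prod>i<length xs. letter_wt (if i = 0 then l else enat (xs ! (i - 1)))
     (enat (xs ! i)) (if Suc i < length xs then enat (xs ! Suc i) else \<infinity>))"
  (is "_ = prod (?w l xs) _")
proof (induction xs arbitrary: l)
  case (Cons x xs)
  have "first_letter xs = (if 0 < length xs then enat (xs ! 0) else \<infinity>)"
    by (cases xs) (auto simp: first_letter_def)
  then have "letter_wt l (enat x) (first_letter xs) = ?w l (x # xs) 0" by simp
  moreover have "?w (enat x) xs i = ?w l (x # xs) (Suc i)" for i
    by (cases i) simp_all
  ultimately show ?case
    unfolding word_wt.simps Cons length_Cons prod.lessThan_Suc_shift by (simp only:)
qed simp

lemma perm_wt_eq_word_wt: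
  "u\<^sub>1 ^ val n \<sigma> * u\<^sub>2 ^ pk n \<sigma> * u\<^sub>3 ^ da n \<sigma> * u\<^sub>4 ^ dd n \<sigma> = word_wt \<infinity> (map \<sigma> [1..<Suc n])"
proof -
  \<comment> \<open>Each statistic counts positions, so its power is a product over positions; the
    four products merge into one product of \<open>letter_wt\<close>.\<close>
  have pow: "u ^ card {j \<in> {1..n}. P j} = (\<Prod>j=1..n. if P j then u else 1)" for u :: 'a and P
    by (simp add: prod.If_cases Int_def)
  have "u\<^sub>1 ^ val n \<sigma> * u\<^sub>2 ^ pk n \<sigma> * u\<^sub>3 ^ da n \<sigma> * u\<^sub>4 ^ dd n \<sigma>
      = (\<Prod>j=1..n. letter_wt (letter n \<sigma> (j - 1)) (letter n \<sigma> j) (letter n \<sigma> (j + 1)))"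
    unfolding val_def pk_def da_def dd_def pow prod.distrib[symmetric] letter_wt_def
      is_valley_def is_peak_def is_double_ascent_def is_double_descent_def ..
  \<comment> \<open>Positions \<open>1..n\<close> become list indices starting at 0.\<close>
  also have "\<dots> = (\<Prod>i<n. letter_wt (letter n \<sigma> i) (letter n \<sigma> (Suc i)) (letter n \<sigma> (Suc (Suc i))))"
    by (rule prod.reindex_bij_witness[of _ Suc "\<lambda>j. j - 1"]) auto
  also have "\<dots> = word_wt \<infinity> (map \<sigma> [1..<Suc n])"
    unfolding word_wt_eq_prod by (rule prod.cong) (auto simp: letter_def nth_append simp del: upt_Suc)
  finally show ?thesis .
qed

section \<open>Recurrence for the total weight of the words on a set\<close>

definition words_wt :: "nat set \<Rightarrow> 'a" where
  "words_wt A = (\<Sum>xs\<in>permutations_of_set A. word_wt \<infinity> xs)"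

text \<open>The cut is at the largest letter \<open>m\<close>, with the letters of \<open>B\<close>
  to its left. Which sides are empty decides the factor of \<open>m\<close>, so these cases stay
  separate.\<close>

lemma words_wt_rec:
  assumes A: "finite A" and m: "\<forall>x\<in>A. x < m"
  shows "words_wt (insert m A) = (\<Sum>B\<in>Pow A.
    if B = {} then if A - B = {} then u\<^sub>1 else u\<^sub>4 * words_wt (A - B)
    else if A - B = {} then u\<^sub>3 * words_wt B else u\<^sub>2 * words_wt B * words_wt (A - B))"
proof -
  have "m \<notin> A" using m by blast
  show ?thesis
    unfolding words_wt_def[of "insert m A"] sum_permutations_of_set_split[OF A \<open>m \<notin> A\<close>]
  proof (intro sum.cong refl)
    fix B assume "B \<in> Pow A"
    then have B: "B \<subseteq> A" by simp
    let ?c = "\<lambda>xs ys. if B = {} then if A - B = {} then u\<^sub>1 else u\<^sub>4 * word_wt \<infinity> ys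
       else word_wt \<infinity> xs * (if A - B = {} then u\<^sub>3 else u\<^sub>2 * word_wt \<infinity> ys)"
    have "(\<Sum>xs\<in>permutations_of_set B. \<Sum>ys\<in>permutations_of_set (A - B). word_wt \<infinity> (xs @ m # ys))
        = (\<Sum>xs\<in>permutations_of_set B. \<Sum>ys\<in>permutations_of_set (A - B). ?c xs ys)"
    proof (intro sum.cong refl)
      fix xs ys assume "xs \<in> permutations_of_set B" "ys \<in> permutations_of_set (A - B)"
      then have s: "set xs = B" "set ys = A - B" by (auto simp: permutations_of_set_def)
      with m B have lt: "\<forall>x\<in>set xs. x < m" "\<forall>y\<in>set ys. y < m" by auto
      have "xs = [] \<longleftrightarrow> B = {}" unfolding s(1)[symmetric] by simp
      moreover have "ys = [] \<longleftrightarrow> A - B = {}" unfolding s(2)[symmetric] by simp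
      ultimately show "word_wt \<infinity> (xs @ m # ys) = ?c xs ys"
        using word_wt_max_first[OF lt(2)] word_wt_max_later[OF _ lt]
        by (cases "xs = []") (simp_all del: word_wt.simps Diff_eq_empty_iff)
    qed
    also have "\<dots> = (if B = {} then if A - B = {} then u\<^sub>1 else u\<^sub>4 * words_wt (A - B)
        else if A - B = {} then u\<^sub>3 * words_wt B else u\<^sub>2 * words_wt B * words_wt (A - B))"
    proof -
      consider "B = {}" "A - B = {}" | "B = {}" "A - B \<noteq> {}" | "B \<noteq> {}" "A - B = {}"
        | "B \<noteq> {}" "A - B \<noteq> {}" by blast
      then show ?thesis
      proof cases
        case 3
        then show ?thesis
          unfolding words_wt_def 3(2) permutations_of_set_empty by (simp add: sum_distrib_left mult.commute)
      next
        case 4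
        then show ?thesis
          unfolding words_wt_def by (simp add: sum_product sum_distrib_left mult_ac)
      qed (auto simp: words_wt_def sum_distrib_left mult.commute simp del: Diff_eq_empty_iff)
    qed
    finally show "(\<Sum>xs\<in>permutations_of_set B. \<Sum>ys\<in>permutations_of_set (A - B). word_wt \<infinity> (xs @ m # ys))
      = (if B = {} then if A - B = {} then u\<^sub>1 else u\<^sub>4 * words_wt (A - B)
        else if A - B = {} then u\<^sub>3 * words_wt B else u\<^sub>2 * words_wt B * words_wt (A - B))" .
  qed
qed

text \<open>Strong induction: cutting at \<open>Max A\<close> gives a binomial convolution, which is
  also the recurrence that the Riccati equation imposes on the coefficients. General sets occur
  because any subset may stand to the left of the maximum.\<close>

lemma words_wt_eq_riccati:
  assumes "finite A" "A \<noteq> {}"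
  shows "words_wt A = fact (card A) * fps_nth (riccati_fps u\<^sub>1 u\<^sub>2 ((u\<^sub>3 + u\<^sub>4) / 2)) (card A)"
  using assms
proof (induction "card A" arbitrary: A rule: less_induct)
  case less
  define F where "F = riccati_fps u\<^sub>1 u\<^sub>2 ((u\<^sub>3 + u\<^sub>4) / 2)"
  define m where "m = Max A"
  define A' where "A' = A - {m}"
  define N where "N = card A'"
  define p where "p k = fact k * fps_nth F k" for k
  have "m \<in> A" using less.prems unfolding m_def by (rule Max_in)
  then have A: "A = insert m A'" "m \<notin> A'" "finite A'"
    using less.prems by (auto simp: A'_def)
  have lt: "\<forall>x\<in>A'. x < m"
    using less.prems by (auto simp: A'_def m_def order_less_le)
  have card: "card A = Suc N" using A by (simp add: N_def)
  have p0: "p 0 = 0" by (simp add: p_def F_def riccati_fps_nth_0)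
  have IH: "words_wt B = p (card B)" if "B \<subseteq> A'" "B \<noteq> {}" for B
  proof -
    have "card B \<le> N" unfolding N_def using that A by (intro card_mono) auto
    then show ?thesis
      unfolding p_def F_def using that A card by (intro less.hyps) (auto intro: finite_subset)
  qed
  \<comment> \<open>The summand for a left part with \<open>k\<close> letters; by induction only
    cardinalities matter.\<close>
  define q where "q k = (if k = 0 then if N = k then u\<^sub>1 else u\<^sub>4 * p (N - k)
     else if N = k then u\<^sub>3 * p k else u\<^sub>2 * p k * p (N - k))" for k
  have "words_wt A = (\<Sum>B\<in>Pow A'. q (card B))"
    unfolding A(1) words_wt_rec[OF A(3) lt]
  proof (intro sum.cong refl)
    fix B assume "B \<in> Pow A'"
    then have B: "B \<subseteq> A'" "finite B" using A finite_subset by auto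
    have c: "card (A' - B) = N - card B" "card B \<le> N"
      unfolding N_def using B A by (simp_all add: card_Diff_subset card_mono)
    have e: "B = {} \<longleftrightarrow> card B = 0" "A' - B = {} \<longleftrightarrow> N = card B"
      using B A(3) c card_0_eq[of "A' - B"] by auto
    have "A' - B \<noteq> {} \<Longrightarrow> words_wt (A' - B) = p (N - card B)"
      using IH[of "A' - B"] c by auto
    with IH[OF B(1)] show "(if B = {} then if A' - B = {} then u\<^sub>1 else u\<^sub>4 * words_wt (A' - B)
        else if A' - B = {} then u\<^sub>3 * words_wt B else u\<^sub>2 * words_wt B * words_wt (A' - B)) = q (card B)"
      unfolding q_def e[symmetric] 
      by (cases "B = {}"; cases "A' - B = {}") (simp_all del: Diff_eq_empty_iff)
  qed
  also have "\<dots> = (\<Sum>k\<le>N. of_nat (N choose k) * q k)"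
    unfolding N_def by (rule sum_Pow_card[OF A(3)])
  \<comment> \<open>Since \<open>p 0 = 0\<close>, the product term vanishes at \<open>k = 0\<close>
    and \<open>k = N\<close>, and the \<open>u\<^sub>3\<close> term vanishes when
    \<open>N = 0\<close>; so the cases can simply be added.\<close>
  also have "\<dots> = (\<Sum>k\<le>N. of_nat (N choose k) * ((if k = 0 then if N = 0 then u\<^sub>1 else u\<^sub>4 * p N else 0)
      + (if k = N then u\<^sub>3 * p N else 0) + u\<^sub>2 * (p k * p (N - k))))"
    by (intro sum.cong refl) (auto simp: q_def p0)
  also have "\<dots> = (if N = 0 then u\<^sub>1 else 0) + (u\<^sub>3 + u\<^sub>4) * p N
      + u\<^sub>2 * (\<Sum>k\<le>N. of_nat (N choose k) * (p k * p (N - k)))"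
    by (simp add: distrib_left sum.distrib sum_distrib_left mult.left_commute if_distrib[of "(*) _"] p0
        distrib_right cong: if_cong)
  \<comment> \<open>The binomial coefficient cancels the factorials in \<open>p\<close>, leaving
    \<open>N!\<close> times a Cauchy product.\<close>
  also have "(\<Sum>k\<le>N. of_nat (N choose k) * (p k * p (N - k))) = fact N * fps_nth (F\<^sup>2) N"
    unfolding power2_eq_square fps_mult_nth sum_distrib_left atLeast0AtMost
    by (intro sum.cong refl) (auto simp: p_def binomial_fact)
  \<comment> \<open>Coefficient \<open>N\<close> of the Riccati equation, where
    \<open>2 c = u\<^sub>3 + u\<^sub>4\<close>.\<close>
  also have "(if N = 0 then u\<^sub>1 else 0) + (u\<^sub>3 + u\<^sub>4) * p N + u\<^sub>2 * (fact N * fps_nth (F\<^sup>2) N)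
      = fact N * fps_nth (fps_deriv F) N"
    unfolding F_def riccati_fps_deriv by (simp add: p_def F_def algebra_simps)
  also have "\<dots> = fact (card A) * fps_nth F (card A)" by (simp add: card algebra_simps)
  finally show ?case unfolding F_def .
qed

lemma sum_perm_wt:
  assumes "n > 0"
  shows "(\<Sum>\<sigma> | \<sigma> permutes {1..n}. u\<^sub>1 ^ val n \<sigma> * u\<^sub>2 ^ pk n \<sigma> * u\<^sub>3 ^ da n \<sigma> * u\<^sub>4 ^ dd n \<sigma>)
    = fact n * fps_nth (riccati_fps u\<^sub>1 u\<^sub>2 ((u\<^sub>3 + u\<^sub>4) / 2)) n"
proof -
  have "(\<Sum>\<sigma> | \<sigma> permutes {1..n}. u\<^sub>1 ^ val n \<sigma> * u\<^sub>2 ^ pk n \<sigma> * u\<^sub>3 ^ da n \<sigma> * u\<^sub>4 ^ dd n \<sigma>)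
      = words_wt {1..n}"
    unfolding perm_wt_eq_word_wt words_wt_def
    by (rule sum.reindex_bij_betw[OF bij_betw_permutes_words])
  then show ?thesis using words_wt_eq_riccati[of "{1..n}"] assms by simp
qed

end

theorem theorem6p1:
  fixes u\<^sub>1 u\<^sub>2 u\<^sub>3 u\<^sub>4 c :: "'a::field_char_0"
  assumes "c = (u\<^sub>3 + u\<^sub>4) / 2"
  shows "cf_has_value
           (\<lambda>k. if k = 0 then fps_const u\<^sub>1 * fps_X else fps_const (c\<^sup>2 - u\<^sub>1 * u\<^sub>2) * fps_X\<^sup>2)
           (\<lambda>k. if k = 0 then 1 - fps_const c * fps_X else of_nat (2 * k + 1))
           (Abs_fps (\<lambda>n. if n = 0 then 0 else
              (\<Sum>\<sigma> | \<sigma> permutes {1..n}.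
                 u\<^sub>1 ^ val n \<sigma> * u\<^sub>2 ^ pk n \<sigma> * u\<^sub>3 ^ da n \<sigma> * u\<^sub>4 ^ dd n \<sigma>) / fact n))"
proof -
  \<comment> \<open>Both series have coefficient 0 at index 0; at \<open>n > 0\<close> the factorial
    cancels.\<close>
  have "Abs_fps (\<lambda>n. if n = 0 then 0 else (\<Sum>\<sigma> | \<sigma> permutes {1..n}.
      u\<^sub>1 ^ val n \<sigma> * u\<^sub>2 ^ pk n \<sigma> * u\<^sub>3 ^ da n \<sigma> * u\<^sub>4 ^ dd n \<sigma>) / fact n) = riccati_fps u\<^sub>1 u\<^sub>2 c"
    by (rule fps_ext) (simp add: sum_perm_wt riccati_fps_nth_0 assms del: One_nat_def)
  then show ?thesis by (simp only: cf_has_value_riccati)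
qed

end
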